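(* Let $>$ be a precedence on a signature $\mathcal{F}$ in which every AC symbol is minimal (there is no $g$ with $f>g$ for $f\in\mathcal{F}_{\mathrm{AC}}$). Then $>_{\mathrm{acmpo}}$ is an incremental, AC-compatible rewrite order with the subterm property.
   Context: $\mathcal{F}$ is a signature of function symbols with arities, $\mathcal{V}$ a countably infinite set of variables, and $\mathcal{F}_{\mathrm{AC}}\subseteq\mathcal{F}$ a set of binary symbols; $=_{\mathrm{AC}}$ is the congruence generated by $f(f(x,y),z)\approx f(x,f(y,z))$ and $f(x,y)\approx f(y,x)$ for $f\in\mathcal{F}_{\mathrm{AC}}$. $\mathrm{root}(t)$ is $t$ if $t$ is a variable and $f$ if $t=f(t_1,\dots,t_n)$. For a non-variable term $t=f(t_1,\dots,t_n)$ the multiset $\mathrm{TF}(t)=\mathrm{TF}_f(t_1)\uplus\cdots\uplus\mathrm{TF}_f(t_n)$, where $\mathrm{TF}_f(u)=\mathrm{TF}_f(u_1)\uplus\mathrm{TF}_f(u_2)$ if $u=f(u_1,u_2)$ and $f\in\mathcal{F}_{\mathrm{AC}}$, and $\mathrm{TF}_f(u)=\{u\}$ otherwise. $=_{\mathrm{AC}}^{\mathrm{mul}}$ is defined by $\varnothing=_{\mathrm{AC}}^{\mathrm{mul}}\varnothing$ and $\{s\}\uplus M=_{\mathrm{AC}}^{\mathrm{mul}}\{t\}\uplus N$ if $s=_{\mathrm{AC}}t$ and $M=_{\mathrm{AC}}^{\mathrm{mul}}N$. A precedence is a strict order $>$ on $\mathcal{F}$. The relation $>_{\mathrm{acmpo}}$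 (depending on $>$) is defined inductively: $s>_{\mathrm{acmpo}}t$ iff $s\notin\mathcal{V}$ and one of: (1) some $s'\in\mathrm{TF}(s)$ satisfies $s'>_{\mathrm{acmpo}}t$ or $s'=_{\mathrm{AC}}t$; (2) $\mathrm{root}(s)>\mathrm{root}(t)$ and $s>_{\mathrm{acmpo}}t'$ for all $t'\in\mathrm{TF}(t)$; (3) $\mathrm{root}(s)=\mathrm{root}(t)$ and $\mathrm{TF}(s)>^{\mathrm{mul}}_{\mathrm{acmpo}}\mathrm{TF}(t)$, where $M>^{\mathrm{mul}}_{\mathrm{acmpo}}N$ means there are multisets with $M=S_1\uplus S_2$, $N=T_1\uplus T_2$, $S_1=_{\mathrm{AC}}^{\mathrm{mul}}T_1$, $S_2\neq\varnothing$, and for every $t'\in T_2$ some $s'\in S_2$ with $s'>_{\mathrm{acmpo}}t'$. A rewrite order is a strict order on terms closed under contexts and substitutions. A relation $\succ$ is AC-compatible if ${=_{\mathrm{AC}}}\cdot{\succ}\cdot{=_{\mathrm{AC}}}\subseteq{\succ}$. It has the subterm property if $t\succ u$ whenever $u$ is a proper subterm of $t$. The construction is incremental if for precedences $>\subseteq\sqsupset$ the order $>_{\mathrm{acmpo}}$ induced by $>$ is contained in the one induced by $\sqsupset$. *)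

theory Defs
  imports "HOL-Library.Multiset" "HOL-Library.Countable_Set"
begin

section \<open>Terms over a signature\<close>

datatype ('f, 'v) trm = Var 'v | Fun 'f "('f, 'v) trm list"

text \<open>
  A signature is a carrier \<open>F\<close> of function symbols with an arity function \<open>ar\<close>. The datatype
  itself ignores \<open>F\<close> and arities; the terms of the paper are those in \<open>terms_over F ar\<close>, and all
  relations on terms below are relations on that set.
\<close>

inductive_set terms_over :: "'f set \<Rightarrow> ('f \<Rightarrow> nat) \<Rightarrow> ('f, 'v) trm set"
  for F :: "'f set" and ar :: "'f \<Rightarrow> nat"
where
  "Var x \<in> terms_over F ar"
| "f \<in> F \<Longrightarrow> length ts = ar f \<Longrightarrow> \<forall>t \<in> set ts. t \<in> terms_over F ar \<Longrightarrow> Fun f ts \<in> terms_over F ar"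

definition ac_signature :: "'f set \<Rightarrow> ('f \<Rightarrow> nat) \<Rightarrow> 'f set \<Rightarrow> bool" where
  "ac_signature F ar Fac \<longleftrightarrow> Fac \<subseteq> F \<and> (\<forall>f \<in> Fac. ar f = 2)"

fun subterms :: "('f, 'v) trm \<Rightarrow> ('f, 'v) trm set" where
  "subterms (Var x) = {Var x}"
| "subterms (Fun f ts) = insert (Fun f ts) (\<Union>t \<in> set ts. subterms t)"

definition proper_subterm :: "('f, 'v) trm \<Rightarrow> ('f, 'v) trm \<Rightarrow> bool" where
  "proper_subterm u t \<longleftrightarrow> u \<in> subterms t \<and> u \<noteq> t"

fun subst :: "('v \<Rightarrow> ('f, 'v) trm) \<Rightarrow> ('f, 'v) trm \<Rightarrow> ('f, 'v) trm" where
  "subst \<sigma> (Var x) = \<sigma> x"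
| "subst \<sigma> (Fun f ts) = Fun f (map (subst \<sigma>) ts)"

datatype ('f, 'v) ctxt =
  Hole | More 'f "('f, 'v) trm list" "('f, 'v) ctxt" "('f, 'v) trm list"

fun fill :: "('f, 'v) ctxt \<Rightarrow> ('f, 'v) trm \<Rightarrow> ('f, 'v) trm" where
  "fill Hole t = t"
| "fill (More f ls C rs) t = Fun f (ls @ fill C t # rs)"

fun ctxt_over :: "'f set \<Rightarrow> ('f \<Rightarrow> nat) \<Rightarrow> ('f, 'v) ctxt \<Rightarrow> bool" where
  "ctxt_over F ar Hole \<longleftrightarrow> True"
| "ctxt_over F ar (More f ls C rs) \<longleftrightarrow>
     f \<in> F \<and> Suc (length ls + length rs) = ar f \<and>
     set ls \<subseteq> terms_over F ar \<and> set rs \<subseteq> terms_over F ar \<and> ctxt_over F ar C"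


section \<open>AC equivalence and top-flattening\<close>

inductive ac_eq :: "'f set \<Rightarrow> ('f \<Rightarrow> nat) \<Rightarrow> 'f set \<Rightarrow> ('f, 'v) trm \<Rightarrow> ('f, 'v) trm \<Rightarrow> bool"
  for F :: "'f set" and ar :: "'f \<Rightarrow> nat" and Fac :: "'f set"
where
  assoc: "f \<in> Fac \<Longrightarrow> s \<in> terms_over F ar \<Longrightarrow> t \<in> terms_over F ar \<Longrightarrow> u \<in> terms_over F ar \<Longrightarrow>
     ac_eq F ar Fac (Fun f [Fun f [s, t], u]) (Fun f [s, Fun f [t, u]])"
| comm: "f \<in> Fac \<Longrightarrow> s \<in> terms_over F ar \<Longrightarrow> t \<in> terms_over F ar \<Longrightarrow>
     ac_eq F ar Fac (Fun f [s, t]) (Fun f [t, s])"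
| refl: "t \<in> terms_over F ar \<Longrightarrow> ac_eq F ar Fac t t"
| sym: "ac_eq F ar Fac s t \<Longrightarrow> ac_eq F ar Fac t s"
| trans: "ac_eq F ar Fac s t \<Longrightarrow> ac_eq F ar Fac t u \<Longrightarrow> ac_eq F ar Fac s u"
| cong: "f \<in> F \<Longrightarrow> length ss = ar f \<Longrightarrow> list_all2 (ac_eq F ar Fac) ss ts \<Longrightarrow>
     ac_eq F ar Fac (Fun f ss) (Fun f ts)"

fun tf_at :: "'f set \<Rightarrow> 'f \<Rightarrow> ('f, 'v) trm \<Rightarrow> ('f, 'v) trm multiset" where
  "tf_at Fac f (Var x) = {#Var x#}"
| "tf_at Fac f (Fun g [u1, u2]) =
     (if g = f \<and> f \<in> Fac then tf_at Fac f u1 + tf_at Fac f u2 else {#Fun g [u1, u2]#})"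
| "tf_at Fac f (Fun g us) = {#Fun g us#}"

text \<open>The value at variables is a dummy; \<open>TF\<close> is only ever applied to non-variable terms.\<close>

fun TF :: "'f set \<Rightarrow> ('f, 'v) trm \<Rightarrow> ('f, 'v) trm multiset" where
  "TF Fac (Var x) = {#}"
| "TF Fac (Fun f ts) = sum_list (map (tf_at Fac f) ts)"

text \<open>
  The library's \<open>rel_mset' R\<close> is the inductive element-by-element matching of two multisets
  along \<open>R\<close>, so that \<open>rel_mset' (ac_eq F ar Fac)\<close> is the multiset extension of AC equivalence.
\<close>

definition ac_mul_gt ::
  "('a \<Rightarrow> 'a \<Rightarrow> bool) \<Rightarrow> ('a \<Rightarrow> 'a \<Rightarrow> bool) \<Rightarrow> 'a multiset \<Rightarrow> 'a multiset \<Rightarrow> bool" where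
  "ac_mul_gt eq gt M N \<longleftrightarrow>
     (\<exists>S1 S2 T1 T2. M = S1 + S2 \<and> N = T1 + T2 \<and> rel_mset' eq S1 T1 \<and> S2 \<noteq> {#} \<and>
        (\<forall>t' \<in># T2. \<exists>s' \<in># S2. gt s' t'))"

lemma ac_mul_gt_mono [mono]:
  assumes "\<And>s t. gt s t \<longrightarrow> gt' s t"
  shows "ac_mul_gt eq gt M N \<longrightarrow> ac_mul_gt eq gt' M N"
proof
  assume "ac_mul_gt eq gt M N"
  then obtain S1 S2 T1 T2 where
    "M = S1 + S2" "N = T1 + T2" "rel_mset' eq S1 T1" "S2 \<noteq> {#}"
    "\<forall>t' \<in># T2. \<exists>s' \<in># S2. gt s' t'"
    unfolding ac_mul_gt_def by blast
  moreover from this(5) assms have "\<forall>t' \<in># T2. \<exists>s' \<in># S2. gt' s' t'" by blast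
  ultimately show "ac_mul_gt eq gt' M N" unfolding ac_mul_gt_def by blast
qed


section \<open>The order\<close>

definition strict_order_over :: "'a set \<Rightarrow> ('a \<Rightarrow> 'a \<Rightarrow> bool) \<Rightarrow> bool" where
  "strict_order_over A gt \<longleftrightarrow>
     (\<forall>x y. gt x y \<longrightarrow> x \<in> A \<and> y \<in> A) \<and> irreflp gt \<and> transp gt"

abbreviation precedence :: "'f set \<Rightarrow> ('f \<Rightarrow> 'f \<Rightarrow> bool) \<Rightarrow> bool" where
  "precedence F prec \<equiv> strict_order_over F prec"

text \<open>
  \<open>prec f g\<close> reads \<open>f > g\<close>. The conditions on root symbols are expressed by the
  patterns \<open>Fun f ss\<close> and \<open>Fun g ts\<close>: a precedence only relates function symbols, so no case
  comparing roots can apply to a variable \<open>t\<close>.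
\<close>

inductive acmpo ::
  "'f set \<Rightarrow> ('f \<Rightarrow> nat) \<Rightarrow> 'f set \<Rightarrow> ('f \<Rightarrow> 'f \<Rightarrow> bool) \<Rightarrow> ('f, 'v) trm \<Rightarrow> ('f, 'v) trm \<Rightarrow> bool"
  for F :: "'f set" and ar :: "'f \<Rightarrow> nat" and Fac :: "'f set" and prec :: "'f \<Rightarrow> 'f \<Rightarrow> bool"
where
  sub: "Fun f ss \<in> terms_over F ar \<Longrightarrow> t \<in> terms_over F ar \<Longrightarrow>
     s' \<in># TF Fac (Fun f ss) \<Longrightarrow> acmpo F ar Fac prec s' t \<or> ac_eq F ar Fac s' t \<Longrightarrow>
     acmpo F ar Fac prec (Fun f ss) t"
| prec: "Fun f ss \<in> terms_over F ar \<Longrightarrow> Fun g ts \<in> terms_over F ar \<Longrightarrow>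
     prec f g \<Longrightarrow> \<forall>t' \<in># TF Fac (Fun g ts). acmpo F ar Fac prec (Fun f ss) t' \<Longrightarrow>
     acmpo F ar Fac prec (Fun f ss) (Fun g ts)"
| mul: "Fun f ss \<in> terms_over F ar \<Longrightarrow> Fun f ts \<in> terms_over F ar \<Longrightarrow>
     ac_mul_gt (ac_eq F ar Fac) (acmpo F ar Fac prec) (TF Fac (Fun f ss)) (TF Fac (Fun f ts)) \<Longrightarrow>
     acmpo F ar Fac prec (Fun f ss) (Fun f ts)"


section \<open>Properties of relations on terms\<close>

definition ctxt_closed :: "'f set \<Rightarrow> ('f \<Rightarrow> nat) \<Rightarrow> (('f, 'v) trm \<Rightarrow> ('f, 'v) trm \<Rightarrow> bool) \<Rightarrow> bool" where
  "ctxt_closed F ar gt \<longleftrightarrow>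
     (\<forall>C s t. ctxt_over F ar C \<longrightarrow> gt s t \<longrightarrow> gt (fill C s) (fill C t))"

text \<open>No finiteness of the domain of \<open>\<sigma>\<close> is required.\<close>

definition subst_closed :: "'f set \<Rightarrow> ('f \<Rightarrow> nat) \<Rightarrow> (('f, 'v) trm \<Rightarrow> ('f, 'v) trm \<Rightarrow> bool) \<Rightarrow> bool" where
  "subst_closed F ar gt \<longleftrightarrow>
     (\<forall>\<sigma> s t. range \<sigma> \<subseteq> terms_over F ar \<longrightarrow> gt s t \<longrightarrow> gt (subst \<sigma> s) (subst \<sigma> t))"

definition rewrite_order :: "'f set \<Rightarrow> ('f \<Rightarrow> nat) \<Rightarrow> (('f, 'v) trm \<Rightarrow> ('f, 'v) trm \<Rightarrow> bool) \<Rightarrow> bool" where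
  "rewrite_order F ar gt \<longleftrightarrow>
     strict_order_over (terms_over F ar) gt \<and> ctxt_closed F ar gt \<and> subst_closed F ar gt"

definition ac_compatible ::
  "'f set \<Rightarrow> ('f \<Rightarrow> nat) \<Rightarrow> 'f set \<Rightarrow> (('f, 'v) trm \<Rightarrow> ('f, 'v) trm \<Rightarrow> bool) \<Rightarrow> bool" where
  "ac_compatible F ar Fac gt \<longleftrightarrow> ac_eq F ar Fac OO gt OO ac_eq F ar Fac \<le> gt"

definition subterm_property ::
  "'f set \<Rightarrow> ('f \<Rightarrow> nat) \<Rightarrow> (('f, 'v) trm \<Rightarrow> ('f, 'v) trm \<Rightarrow> bool) \<Rightarrow> bool" where
  "subterm_property F ar gt \<longleftrightarrow>
     (\<forall>t \<in> terms_over F ar. \<forall>u. proper_subterm u t \<longrightarrow> gt t u)"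

text \<open>Incrementality is a property of the construction \<open>ord\<close> mapping precedences to relations.\<close>

definition incremental ::
  "'f set \<Rightarrow> (('f \<Rightarrow> 'f \<Rightarrow> bool) \<Rightarrow> ('f, 'v) trm \<Rightarrow> ('f, 'v) trm \<Rightarrow> bool) \<Rightarrow> bool" where
  "incremental F ord \<longleftrightarrow>
     (\<forall>p q. precedence F p \<longrightarrow> precedence F q \<longrightarrow> p \<le> q \<longrightarrow> ord p \<le> ord q)"

end

theory Submission
  imports Defs
begin

text \<open>
  AC-equivalent terms have the same root and pairwise equivalent top-flattenings, which gives
  AC-compatibility by induction on the order. Transitivity follows by induction on the sizes of the
  three terms. For irreflexivity, \<open>TF s > TF s\<close> is impossible since, after cancelling equivalence
  classes, a finite nonempty set would have no maximal element. Closure under contexts rests on the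
  fact that \<open>s > t\<close> implies \<open>tf_at f s > tf_at f t\<close>: when \<open>f\<close> is an AC symbol rooting \<open>s\<close>,
  minimality of \<open>f\<close> excludes the precedence case. Closure under substitutions uses the subterm
  property, as an instantiated variable may flatten into several proper subterms.
\<close>

section \<open>Multiset comparison modulo an equivalence\<close>

lemma rel_mset_union:
  "rel_mset R A B \<Longrightarrow> rel_mset R C D \<Longrightarrow> rel_mset R (A + C) (B + D)"
  by (induction rule: rel_mset_induct) (auto intro: rel_mset_Plus)

text \<open>Carries a decomposition of one multiset over to any multiset matched with it.\<close>

lemma rel_mset_split_left:
  assumes "rel_mset R (A + B) N"
  obtains N1 N2 where "N = N1 + N2" "rel_mset R A N1" "rel_mset R B N2"
  using assms
proof (induction A arbitrary: N thesis)
  case empty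
  show ?case by (rule empty(1)[of "{#}" N]) (use empty(2) in auto)
next
  case (add a A)
  from add.prems(2) obtain N' b where N: "N = add_mset b N'" "R a b" "rel_mset R (A + B) N'"
    using msed_rel_invL[of R a "A + B" N] by auto
  from add.IH[OF _ N(3)] obtain N1 N2 where "N' = N1 + N2" "rel_mset R A N1" "rel_mset R B N2"
    by blast
  with N show ?case by (intro add.prems(1)[of "add_mset b N1" N2]) (auto intro: rel_mset_Plus)
qed

lemma rel_mset_conversep: "rel_mset R\<inverse>\<inverse> M N = rel_mset R N M"
  by (simp add: multiset.rel_conversep)

lemma rel_mset_split_right:
  assumes "rel_mset R N (A + B)"
  obtains N1 N2 where "N = N1 + N2" "rel_mset R N1 A" "rel_mset R N2 B"
  using rel_mset_split_left[of "R\<inverse>\<inverse>" A B N] assms unfolding rel_mset_conversep by blast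

lemma rel_mset_memL: "rel_mset R M N \<Longrightarrow> a \<in># M \<Longrightarrow> \<exists>b \<in># N. R a b"
  by (induction rule: rel_mset_induct) auto

lemma rel_mset_memR: "rel_mset R M N \<Longrightarrow> b \<in># N \<Longrightarrow> \<exists>a \<in># M. R a b"
  by (induction rule: rel_mset_induct) auto

lemma rel_mset_reflI: "(\<And>x. x \<in># M \<Longrightarrow> R x x) \<Longrightarrow> rel_mset R M M"
  by (induction M) (auto intro: rel_mset_Plus rel_mset_Zero)

lemma rel_mset_trans:
  assumes "rel_mset R A B" "rel_mset R B C" "\<And>x y z. R x y \<Longrightarrow> R y z \<Longrightarrow> R x z"
  shows "rel_mset R A C"
proof -
  have "rel_mset (R OO R) A C" using assms(1,2) by (auto simp: multiset.rel_compp)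
  then show ?thesis by (rule multiset.rel_mono_strong) (use assms(3) in auto)
qed

lemma rel_mset_sum_list:
  "list_all2 (\<lambda>x y. rel_mset R (f x) (g y)) xs ys \<Longrightarrow>
    rel_mset R (sum_list (map f xs)) (sum_list (map g ys))"
  by (induction rule: list_all2_induct) (auto intro: rel_mset_union rel_mset_Zero)

lemma rel_mset_sum_mset:
  "rel_mset S M N \<Longrightarrow> (\<And>x y. S x y \<Longrightarrow> rel_mset R (f x) (f y)) \<Longrightarrow>
    rel_mset R (\<Sum>x\<in>#M. f x) (\<Sum>x\<in>#N. f x)"
  by (induction rule: rel_mset_induct) (auto intro: rel_mset_union rel_mset_Zero)

lemma rel_mset_image_eq:
  "rel_mset R M N \<Longrightarrow> (\<And>x y. R x y \<Longrightarrow> f x = f y) \<Longrightarrow> image_mset f M = image_mset f N"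
  by (induction rule: rel_mset_induct) auto

text \<open>Here \<open>P\<close> is the intersection of \<open>A\<close> and \<open>C\<close>,
  \<open>Q\<close> and \<open>R\<close> are the two differences, and \<open>S\<close> is the
  intersection of \<open>B\<close> and \<open>D\<close>. At each element at most one of the
  differences counts, and it equals the opposite difference between \<open>B\<close> and
  \<open>D\<close>.\<close>

lemma multiset_common_refinement:
  fixes A B C D :: "'a multiset"
  assumes "A + B = C + D"
  obtains P Q R S where "A = P + Q" "B = R + S" "C = P + R" "D = Q + S"
proof
  have c: "count A x + count B x = count C x + count D x" for x
    using assms by (metis count_union)
  show "A = A \<inter># C + (A - C)" "C = A \<inter># C + (C - A)"
    by (auto simp: multiset_eq_iff)
  show "B = (C - A) + B \<inter># D" "D = (A - C) + B \<inter># D"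
    unfolding multiset_eq_iff count_union count_diff count_inter_mset
  proof (safe)
    fix x
    show "count B x = count C x - count A x + min (count B x) (count D x)"
      "count D x = count A x - count C x + min (count B x) (count D x)"
      using c[of x] by linarith+
  qed
qed

section \<open>The multiset extension modulo an equivalence\<close>

lemma ac_mul_gtI:
  "\<lbrakk>M = S1 + S2; N = T1 + T2; rel_mset eq S1 T1; S2 \<noteq> {#};
    \<And>t. t \<in># T2 \<Longrightarrow> \<exists>s \<in># S2. gt s t\<rbrakk> \<Longrightarrow> ac_mul_gt eq gt M N"
  unfolding ac_mul_gt_def rel_mset_rel_mset' by blast

lemma ac_mul_gtE:
  assumes "ac_mul_gt eq gt M N"
  obtains S1 S2 T1 T2 where "M = S1 + S2" "N = T1 + T2" "rel_mset eq S1 T1" "S2 \<noteq> {#}"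
    "\<And>t. t \<in># T2 \<Longrightarrow> \<exists>s \<in># S2. gt s t"
  using assms unfolding ac_mul_gt_def rel_mset_rel_mset' by blast

lemma ac_mul_gt_memR:
  "ac_mul_gt eq gt M N \<Longrightarrow> t \<in># N \<Longrightarrow> \<exists>s \<in># M. gt s t \<or> eq s t"
  by (elim ac_mul_gtE) (auto dest: rel_mset_memR)

text \<open>The two decompositions of \<open>N\<close> are refined to a common one. Only its part
  \<open>P\<close>, matched on both sides, stays matched; the rest of \<open>K\<close> is dominated
  through \<open>N\<close>. Transitivity of \<open>gt\<close> is asked only of elements of the three
  multisets, so that an induction hypothesis on term size can supply it.\<close>

lemma ac_mul_gt_trans:
  assumes MN: "ac_mul_gt eq gt M N" and NK: "ac_mul_gt eq gt N K"
    and gt_gt: "\<And>a b c. a \<in># M \<Longrightarrow> b \<in># N \<Longrightarrow> c \<in># K \<Longrightarrow> gt a b \<Longrightarrow> gt b c \<Longrightarrow> gt a c"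
    and gt_eq: "\<And>a b c. gt a b \<Longrightarrow> eq b c \<Longrightarrow> gt a c"
    and eq_gt: "\<And>a b c. eq a b \<Longrightarrow> gt b c \<Longrightarrow> gt a c"
    and eq_eq: "\<And>a b c. eq a b \<Longrightarrow> eq b c \<Longrightarrow> eq a c"
  shows "ac_mul_gt eq gt M K"
proof -
  from MN obtain S1 S2 T1 T2 where 1: "M = S1 + S2" "N = T1 + T2" "rel_mset eq S1 T1" "S2 \<noteq> {#}"
    "\<And>t. t \<in># T2 \<Longrightarrow> \<exists>s \<in># S2. gt s t" by (rule ac_mul_gtE) blast
  from NK obtain V1 V2 U1 U2 where 2: "N = V1 + V2" "K = U1 + U2" "rel_mset eq V1 U1" "V2 \<noteq> {#}"
    "\<And>t. t \<in># U2 \<Longrightarrow> \<exists>s \<in># V2. gt s t" by (rule ac_mul_gtE) blast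
  from 1(2) 2(1) obtain P Q R S where 3: "T1 = P + Q" "T2 = R + S" "V1 = P + R" "V2 = Q + S"
    using multiset_common_refinement[of T1 T2 V1 V2] by metis
  from 1(3)[unfolded 3] obtain SP SQ where 4: "S1 = SP + SQ" "rel_mset eq SP P" "rel_mset eq SQ Q"
    by (rule rel_mset_split_right)
  from 2(3)[unfolded 3] obtain UP UR where 5: "U1 = UP + UR" "rel_mset eq P UP" "rel_mset eq R UR"
    by (rule rel_mset_split_left)
  show ?thesis
  proof (rule ac_mul_gtI[of M SP "SQ + S2" K UP "UR + U2"])
    show "rel_mset eq SP UP" using 4 5 eq_eq by (blast intro: rel_mset_trans)
    fix u assume "u \<in># UR + U2"
    then consider "u \<in># UR" | "u \<in># U2" by auto
    then show "\<exists>s \<in># SQ + S2. gt s u"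
    proof cases
      case 1
      then obtain t where "t \<in># R" "eq t u" using 5(3) rel_mset_memR by metis
      with \<open>\<And>t. t \<in># T2 \<Longrightarrow> \<exists>s \<in># S2. gt s t\<close>[of t] 3(2) show ?thesis by (auto intro: gt_eq)
    next
      case u: 2
      then obtain t where t: "t \<in># Q + S" "gt t u" using 2(5) 3(4) by blast
      show ?thesis
      proof (cases "t \<in># Q")
        case True
        then obtain s where "s \<in># SQ" "eq s t" using 4(3) rel_mset_memR by metis
        with t(2) show ?thesis by (auto intro: eq_gt)
      next
        case False
        with t have "t \<in># T2" using 3(2) by auto
        then obtain s where "s \<in># S2" "gt s t" using 1(5) by blast
        with t(2) u \<open>t \<in># T2\<close> show ?thesis
          using gt_gt[of s t u] 1(1,2) 2(2) by auto
      qed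
    qed
  qed (use 1 2 4 5 in \<open>auto simp: ac_simps\<close>)
qed

text \<open>Cancelling the equivalence classes of the matched parts shows that the strict parts have the
  same classes; each of these finitely many classes is then below another one.\<close>

lemma ac_mul_gt_irrefl:
  assumes irr: "\<And>a. a \<in># M \<Longrightarrow> \<not> gt a a"
    and trans: "\<And>a b c. gt a b \<Longrightarrow> gt b c \<Longrightarrow> gt a c"
    and gt_eq: "\<And>a b c. gt a b \<Longrightarrow> eq b c \<Longrightarrow> gt a c"
    and eq_sym: "\<And>a b. eq a b \<Longrightarrow> eq b a"
    and eq_trans: "\<And>a b c. eq a b \<Longrightarrow> eq b c \<Longrightarrow> eq a c"
    and eq_refl: "\<And>a. a \<in># M \<Longrightarrow> eq a a"
  shows "\<not> ac_mul_gt eq gt M M"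
proof
  assume "ac_mul_gt eq gt M M"
  then obtain S1 S2 T1 T2 where *: "M = S1 + S2" "M = T1 + T2" "rel_mset eq S1 T1" "S2 \<noteq> {#}"
    "\<And>t. t \<in># T2 \<Longrightarrow> \<exists>s \<in># S2. gt s t" by (rule ac_mul_gtE) blast
  let ?c = "\<lambda>x. {y. eq x y}"
  have "image_mset ?c S1 = image_mset ?c T1"
    by (rule rel_mset_image_eq[OF *(3)]) (auto intro: eq_sym eq_trans)
  with *(1,2) have eq: "image_mset ?c S2 = image_mset ?c T2"
    by (metis add_left_cancel image_mset_union)
  have "\<exists>b \<in># S2. gt b a" if "a \<in># S2" for a
  proof -
    from that have "?c a \<in># image_mset ?c T2" by (simp flip: eq)
    then obtain t where t: "t \<in># T2" "?c a = ?c t" by auto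
    then have "eq t a" using eq_refl[of t] eq_refl[of a] that *(1,2) by auto
    with t *(5)[of t] show ?thesis by (auto intro: gt_eq)
  qed
  \<comment> \<open>Taken for the converse, so that no other element of \<open>S2\<close> lies above
    \<open>m\<close>; the previous claim provides one that does, and irreflexivity makes it
    different from \<open>m\<close>.\<close>
  moreover have "\<exists>m \<in> set_mset S2. \<forall>x \<in> set_mset S2. x \<noteq> m \<longrightarrow> \<not> gt\<inverse>\<inverse> m x"
  proof (rule Finite_Set.bex_max_element)
    show "asymp_on (set_mset S2) gt\<inverse>\<inverse>"
      using irr *(1) trans by (intro asymp_onI) (metis conversep_iff union_iff)
    show "transp_on (set_mset S2) gt\<inverse>\<inverse>"
      using trans by (auto intro!: transp_onI)
  qed (use *(4) in auto)
  ultimately show False using irr *(1) by (metis conversepI union_iff)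
qed


section \<open>Terms and top-flattening\<close>

lemma terms_over_Fun [simp]:
  "Fun f ts \<in> terms_over F ar \<longleftrightarrow> f \<in> F \<and> length ts = ar f \<and> (\<forall>t \<in> set ts. t \<in> terms_over F ar)"
  by (auto elim: terms_over.cases intro: terms_over.intros)

lemma terms_over_subst:
  "t \<in> terms_over F ar \<Longrightarrow> range \<sigma> \<subseteq> terms_over F ar \<Longrightarrow> subst \<sigma> t \<in> terms_over F ar"
  by (induction t) auto

lemma subterms_refl [simp]: "t \<in> subterms t"
  by (cases t) auto

lemma terms_over_subterms:
  "t \<in> terms_over F ar \<Longrightarrow> u \<in> subterms t \<Longrightarrow> u \<in> terms_over F ar"
  by (induction t) auto

lemma subst_subterms: "u \<in> subterms t \<Longrightarrow> subst \<sigma> u \<in> subterms (subst \<sigma> t)"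
  by (induction t) auto

lemma size_subterms: "u \<in> subterms t \<Longrightarrow> size u \<le> size t"
proof (induction t)
  case (Fun f ts)
  show ?case
  proof (cases "u = Fun f ts")
    case False
    with Fun.prems obtain t where t: "t \<in> set ts" "u \<in> subterms t" by auto
    with Fun.IH[of t] have "size u \<le> size t" by blast
    also have "size t \<le> size_list size ts" using t(1) by (rule size_list_estimation') simp
    finally show ?thesis by simp
  qed simp
qed simp

section \<open>Flattening and its behaviour under substitution\<close>

lemma tf_at_Fun:
  "tf_at Fac f (Fun g us) =
    (if g = f \<and> f \<in> Fac \<and> length us = 2 then TF Fac (Fun f us) else {#Fun g us#})"
  by (cases "(Fac, f, Fun g us)" rule: tf_at.cases) (auto simp: numeral_2_eq_2)

lemma tf_at_subterms: "u \<in># tf_at Fac f t \<Longrightarrow> u \<in> subterms t"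
  by (induction Fac f t rule: tf_at.induct) (auto split: if_splits)

lemma tf_at_nonempty [simp]: "tf_at Fac f t \<noteq> {#}"
  by (induction Fac f t rule: tf_at.induct) (auto split: if_splits)

lemma set_sum_list_mset: "set_mset (sum_list (map f xs)) = (\<Union>x \<in> set xs. set_mset (f x))"
  by (induction xs) auto

lemma TF_subterms_args:
  "u \<in># TF Fac (Fun f ts) \<Longrightarrow> \<exists>t \<in> set ts. u \<in> subterms t"
  by (auto simp: set_sum_list_mset dest: tf_at_subterms)

lemma TF_subterms: "u \<in># TF Fac t \<Longrightarrow> u \<in> subterms t"
  by (cases t) (auto dest: TF_subterms_args simp del: TF.simps(2))

text \<open>Pieces are subterms of arguments; this strict decrease drives the inductions on size
  below.\<close>

lemma TF_size:
  assumes "u \<in># TF Fac t"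
  shows "size u < size t"
proof (cases t)
  case (Fun f ts)
  with assms obtain t' where t': "t' \<in> set ts" "u \<in> subterms t'"
    using TF_subterms_args by metis
  then have "size u \<le> size t'" by (intro size_subterms)
  also have "size t' \<le> size_list size ts" using t'(1) by (rule size_list_estimation') simp
  finally show ?thesis by (simp add: Fun)
qed (use assms in simp)

lemma TF_proper_subterm: "u \<in># TF Fac t \<Longrightarrow> proper_subterm u t"
  unfolding proper_subterm_def by (auto dest: TF_subterms TF_size)

text \<open>Distinct terms may have equal instances, so properness is recovered from sizes: the
  instance of \<open>u\<close> fits into the instance of an argument.\<close>

lemma proper_subterm_subst:
  assumes "proper_subterm u t"
  shows "proper_subterm (subst \<sigma> u) (subst \<sigma> t)"
proof (cases t)
  case (Fun f ts)
  with assms obtain t' where t': "t' \<in> set ts" "u \<in> subterms t'"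
    unfolding proper_subterm_def by auto
  have "size (subst \<sigma> u) \<le> size (subst \<sigma> t')" by (intro size_subterms subst_subterms t')
  also have "\<dots> \<le> size_list size (map (subst \<sigma>) ts)"
    by (rule size_list_estimation'[of "subst \<sigma> t'"]) (use t' in auto)
  finally have "size (subst \<sigma> u) < size (subst \<sigma> t)" by (simp add: Fun)
  moreover have "subst \<sigma> u \<in> subterms (subst \<sigma> t)"
    using assms by (intro subst_subterms) (simp add: proper_subterm_def)
  ultimately show ?thesis unfolding proper_subterm_def by auto
qed (use assms in \<open>simp add: proper_subterm_def\<close>)

text \<open>Instances keep the symbols dissolved in flattening \<open>t\<close>, so the flattening
  can be done in two rounds; in the second only variables can still open up.\<close>

lemma tf_at_subst:
  "tf_at Fac f (subst \<sigma> t) = (\<Sum>u\<in>#tf_at Fac f t. tf_at Fac f (subst \<sigma> u))"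
  by (induction Fac f t rule: tf_at.induct) auto

lemma TF_subst:
  "TF Fac (subst \<sigma> (Fun f ts)) = (\<Sum>u\<in>#TF Fac (Fun f ts). tf_at Fac f (subst \<sigma> u))"
proof (induction ts)
  case (Cons t ts)
  then show ?case using tf_at_subst[of Fac f \<sigma> t] by simp
qed simp

lemma tf_at_top:
  "Fun g us \<in># tf_at Fac f t \<Longrightarrow> \<not> (g = f \<and> f \<in> Fac \<and> length us = 2)"
  by (induction Fac f t rule: tf_at.induct) (auto split: if_splits)

text \<open>Ensures that a non-variable piece stays whole when it is flattened again, before or
  after instantiation.\<close>

lemma TF_top:
  "Fun g us \<in># TF Fac (Fun f ts) \<Longrightarrow> \<not> (g = f \<and> f \<in> Fac \<and> length us = 2)"
  using tf_at_top by (fastforce simp: set_sum_list_mset)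

lemma tf_at_cases:
  obtains (atom) "tf_at Fac f t = {#t#}"
  | (flat) ts where "f \<in> Fac" "t = Fun f ts" "tf_at Fac f t = TF Fac t"
proof (cases "\<exists>ts. t = Fun f ts \<and> f \<in> Fac \<and> length ts = 2")
  case True
  with flat show thesis by (auto simp: tf_at_Fun simp del: TF.simps)
next
  case False
  then have "tf_at Fac f t = {#t#}" by (cases t) (auto simp: tf_at_Fun simp del: TF.simps)
  with atom show thesis .
qed

text \<open>Isolates the share of one argument. The shortened list may violate the arity of
  \<open>f\<close>, which is harmless because \<open>TF\<close> is defined on all argument
  lists.\<close>

lemma TF_Fun_split:
  "TF Fac (Fun f (ls @ t # rs)) = TF Fac (Fun f (ls @ rs)) + tf_at Fac f t"
  by (simp add: ac_simps)


section \<open>Properties of the order\<close>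

locale ac_precedence =
  fixes F :: "'f set" and ar :: "'f \<Rightarrow> nat" and Fac :: "'f set" and prec :: "'f \<Rightarrow> 'f \<Rightarrow> bool"
  assumes sig: "ac_signature F ar Fac" and prec_order: "precedence F prec"
begin

abbreviation T :: "('f, 'v) trm set" where
  "T \<equiv> terms_over F ar"

abbreviation eq :: "('f, 'v) trm \<Rightarrow> ('f, 'v) trm \<Rightarrow> bool" (infix "\<approx>" 50) where
  "s \<approx> t \<equiv> ac_eq F ar Fac s t"

abbreviation gt :: "('f, 'v) trm \<Rightarrow> ('f, 'v) trm \<Rightarrow> bool" (infix "\<succ>" 50) where
  "s \<succ> t \<equiv> acmpo F ar Fac prec s t"

section \<open>Well-formedness of pieces and of AC-equivalent terms\<close>

lemma AC_symbol: "f \<in> Fac \<Longrightarrow> f \<in> F" "f \<in> Fac \<Longrightarrow> ar f = 2"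
  using sig unfolding ac_signature_def by auto

lemma AC_args:
  assumes "f \<in> Fac" "Fun f ts \<in> T"
  obtains x y where "ts = [x, y]"
  using assms AC_symbol by (auto simp: numeral_2_eq_2 length_Suc_conv)

lemma TF_terms: "t \<in> T \<Longrightarrow> u \<in># TF Fac t \<Longrightarrow> u \<in> T"
  by (blast intro: terms_over_subterms TF_subterms)

lemma tf_at_terms: "t \<in> T \<Longrightarrow> u \<in># tf_at Fac f t \<Longrightarrow> u \<in> T"
  by (blast intro: terms_over_subterms tf_at_subterms)

lemma eq_terms:
  assumes "s \<approx> t"
  shows "s \<in> T" "t \<in> T"
proof -
  have "s \<in> T \<and> t \<in> T" using assms
  proof (induction rule: ac_eq.induct)
    case (cong f ss ts)
    then show ?case by (auto simp: list_all2_conv_all_nth in_set_conv_nth)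
  qed (auto simp: AC_symbol)
  then show "s \<in> T" "t \<in> T" by auto
qed

section \<open>Roots and flattenings modulo AC equivalence\<close>

lemma eq_root: "s \<approx> t \<Longrightarrow> (\<exists>x. s = Var x \<and> t = Var x) \<or> (\<exists>f ss ts. s = Fun f ss \<and> t = Fun f ts)"
proof (induction rule: ac_eq.induct)
  case (refl t)
  then show ?case by (cases t) auto
qed auto

lemma eq_FunE:
  assumes "Fun f ss \<approx> t"
  obtains ts where "t = Fun f ts"
  using eq_root[OF assms] by auto

lemma rel_mset_eq_refl: "(\<And>u. u \<in># M \<Longrightarrow> u \<in> T) \<Longrightarrow> rel_mset (\<approx>) M M"
  by (rule rel_mset_reflI) (rule ac_eq.refl)

text \<open>Both claims go through one induction: congruence needs \<open>tf_at\<close> of the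
  arguments to obtain \<open>TF\<close> of the whole, and \<open>TF\<close> in turn gives
  \<open>tf_at\<close>.\<close>

lemma eq_flatten:
  assumes "s \<approx> t"
  shows eq_TF: "rel_mset (\<approx>) (TF Fac s) (TF Fac t)"
    and eq_tf_at: "rel_mset (\<approx>) (tf_at Fac f s) (tf_at Fac f t)"
proof -
  \<comment> \<open>Equal lengths make both terms either dissolve, which leaves \<open>TF\<close>,
    or remain single pieces.\<close>
  have tf: "rel_mset (\<approx>) (tf_at Fac g (Fun f ss)) (tf_at Fac g (Fun f ts))"
    if "rel_mset (\<approx>) (TF Fac (Fun f ss)) (TF Fac (Fun f ts))" "Fun f ss \<approx> Fun f ts"
      "length ss = length ts" for f g ss ts
    using that by (auto simp: tf_at_Fun simp del: TF.simps intro: rel_mset_Plus rel_mset_Zero)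
  have "rel_mset (\<approx>) (TF Fac s) (TF Fac t) \<and>
      (\<forall>f. rel_mset (\<approx>) (tf_at Fac f s) (tf_at Fac f t))"
    using assms
  proof (induction rule: ac_eq.induct)
    case (assoc f s t u)
    then have "rel_mset (\<approx>) (TF Fac (Fun f [Fun f [s, t], u])) (TF Fac (Fun f [s, Fun f [t, u]]))"
      by (auto simp: ac_simps intro!: rel_mset_eq_refl dest: tf_at_terms)
    then show ?case using assoc by (intro conjI allI tf ac_eq.assoc) simp_all
  next
    case (comm f s t)
    then have "rel_mset (\<approx>) (TF Fac (Fun f [s, t])) (TF Fac (Fun f [t, s]))"
      by (auto simp: ac_simps intro!: rel_mset_eq_refl dest: tf_at_terms)
    then show ?case using comm by (intro conjI allI tf ac_eq.comm) simp_all
  next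
    case (refl t)
    then show ?case by (auto intro!: rel_mset_eq_refl dest: tf_at_terms TF_terms)
  next
    case (sym s t)
    have "rel_mset (\<approx>) N M" if "rel_mset (\<approx>) M N" for M N :: "('f, 'b) trm multiset"
      using that unfolding rel_mset_conversep[of _ N M, symmetric]
      by (rule multiset.rel_mono_strong) (auto intro: ac_eq.sym)
    with sym show ?case by blast
  next
    case (trans s t u)
    then show ?case by (blast intro: rel_mset_trans ac_eq.trans)
  next
    case (cong f ss ts)
    then have "rel_mset (\<approx>) (TF Fac (Fun f ss)) (TF Fac (Fun f ts))"
      by (auto intro!: rel_mset_sum_list elim: list_all2_mono)
    moreover have "Fun f ss \<approx> Fun f ts"
      using cong by (intro ac_eq.cong) (auto elim: list_all2_mono)
    ultimately show ?case
      using cong by (auto intro!: tf simp del: TF.simps dest: list_all2_lengthD)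
  qed
  then show "rel_mset (\<approx>) (TF Fac s) (TF Fac t)"
    "rel_mset (\<approx>) (tf_at Fac f s) (tf_at Fac f t)" by auto
qed

section \<open>Inversion of the order and AC-compatibility\<close>

lemma gt_terms:
  assumes "s \<succ> t"
  shows "s \<in> T" and "t \<in> T"
  using assms by (cases rule: acmpo.cases, simp_all)+

lemma gt_cases [consumes 1, case_names sub prec mul]:
  assumes "s \<succ> t"
  obtains f ss u where "s = Fun f ss" "u \<in># TF Fac s" "u \<succ> t \<or> u \<approx> t"
  | f ss g ts where "s = Fun f ss" "t = Fun g ts" "prec f g" "\<And>u. u \<in># TF Fac t \<Longrightarrow> s \<succ> u"
  | f ss ts where "s = Fun f ss" "t = Fun f ts" "ac_mul_gt (\<approx>) (\<succ>) (TF Fac s) (TF Fac t)"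
  using assms
proof (cases rule: acmpo.cases)
  case (sub f ss u)
  then show thesis using that(1)[of f ss u] by simp
next
  case (prec f ss g ts)
  then show thesis by (intro that(2)[of f ss g ts]) (simp_all del: TF.simps)
next
  case (mul f ss ts)
  then show thesis using that(3)[of f ss ts] by simp
qed

lemma gt_subI:
  assumes "s \<in> T" "u \<in># TF Fac s" "u \<succ> t \<or> u \<approx> t"
  shows "s \<succ> t"
proof (cases s)
  case (Fun f ss)
  have "t \<in> T" using assms(3) gt_terms(2) eq_terms(2) by blast
  with assms show ?thesis unfolding Fun by (intro acmpo.sub[of f ss F ar t u])
qed (use assms in simp)

lemma gt_TF: "s \<in> T \<Longrightarrow> u \<in># TF Fac s \<Longrightarrow> s \<succ> u"
  by (rule gt_subI) (auto intro: ac_eq.refl TF_terms)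

text \<open>A clause depends only on roots, on flattenings and on comparisons involving a piece;
  \<open>eq_root\<close> and \<open>eq_flatten\<close> preserve the former, induction the latter.
  Both sides change at once because the \<open>prec\<close> and \<open>mul\<close> cases use the
  hypothesis for pairs in which both terms are replaced.\<close>

lemma gt_compat:
  assumes "s \<succ> t" "s \<approx> s'" "t \<approx> t'"
  shows "s' \<succ> t'"
  using assms
proof (induction arbitrary: s' t' rule: acmpo.induct)
  case (sub f ss t u)
  obtain u' where "u' \<in># TF Fac s'" "u \<approx> u'"
    using rel_mset_memL[OF eq_TF[OF sub.prems(1)] sub.hyps(3)] by blast
  moreover from this sub.IH sub.prems(2) have "u' \<succ> t' \<or> u' \<approx> t'"
    using ac_eq.trans[of F ar Fac u' u t'] ac_eq.trans[of F ar Fac u t t'] ac_eq.sym[of F ar Fac u u']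
    by metis
  ultimately show ?case using eq_terms(2)[OF sub.prems(1)] by (intro gt_subI[of s' u'])
next
  case (prec f ss g ts)
  from prec.prems obtain ss' ts' where [simp]: "s' = Fun f ss'" "t' = Fun g ts'"
    by (metis eq_FunE)
  have "s' \<succ> u'" if "u' \<in># TF Fac t'" for u'
    using rel_mset_memR[OF eq_TF[OF prec.prems(2)] that] prec.IH prec.prems(1) by blast
  with prec show ?case using eq_terms(2) by (auto intro!: acmpo.prec simp del: TF.simps terms_over_Fun)
next
  case (mul f ss ts)
  from mul.prems obtain ss' ts' where [simp]: "s' = Fun f ss'" "t' = Fun f ts'"
    by (metis eq_FunE)
  from mul.IH obtain S1 S2 T1 T2 where
    *: "TF Fac (Fun f ss) = S1 + S2" "TF Fac (Fun f ts) = T1 + T2" "rel_mset (\<approx>) S1 T1" "S2 \<noteq> {#}"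
    and gt: "\<And>t. t \<in># T2 \<Longrightarrow> \<exists>s \<in># S2. \<forall>s' t'. s \<approx> s' \<longrightarrow> t \<approx> t' \<longrightarrow> s' \<succ> t'"
    by (rule ac_mul_gtE) blast
  \<comment> \<open>The decompositions behind the old comparison are carried along the matchings of
    the flattenings.\<close>
  from eq_TF[OF mul.prems(1), unfolded *] obtain S1' S2' where
    S: "TF Fac s' = S1' + S2'" "rel_mset (\<approx>) S1 S1'" "rel_mset (\<approx>) S2 S2'"
    by (rule rel_mset_split_left)
  from eq_TF[OF mul.prems(2), unfolded *] obtain T1' T2' where
    T: "TF Fac t' = T1' + T2'" "rel_mset (\<approx>) T1 T1'" "rel_mset (\<approx>) T2 T2'"
    by (rule rel_mset_split_left)
  have S': "rel_mset (\<approx>) S1' S1"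
    using S(2) unfolding rel_mset_conversep[of _ S1' S1, symmetric]
    by (rule multiset.rel_mono_strong) (auto intro: ac_eq.sym)
  have "ac_mul_gt (\<approx>) (\<succ>) (TF Fac s') (TF Fac t')"
  proof (rule ac_mul_gtI[OF S(1) T(1)])
    show "rel_mset (\<approx>) S1' T1'"
      by (rule rel_mset_trans[OF S' rel_mset_trans[OF *(3) T(2)]]) (fact ac_eq.trans)+
    show "S2' \<noteq> {#}" using S(3) *(4) by auto
    fix t assume "t \<in># T2'"
    then obtain t0 where "t0 \<in># T2" "t0 \<approx> t" using rel_mset_memR[OF T(3)] by blast
    moreover from this gt obtain s0 where
      "s0 \<in># S2" "\<And>s' t'. s0 \<approx> s' \<Longrightarrow> t0 \<approx> t' \<Longrightarrow> s' \<succ> t'" by blast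
    moreover from this obtain s where "s \<in># S2'" "s0 \<approx> s" using rel_mset_memL[OF S(3)] by blast
    ultimately show "\<exists>s \<in># S2'. s \<succ> t" by blast
  qed
  with mul.prems show ?case using eq_terms(2) by (auto intro!: acmpo.mul simp del: TF.simps terms_over_Fun)
qed

lemma gt_eq: "s \<succ> t \<Longrightarrow> t \<approx> u \<Longrightarrow> s \<succ> u"
  by (rule gt_compat[of s t]) (auto intro: ac_eq.refl gt_terms)

lemma eq_gt: "s \<approx> t \<Longrightarrow> t \<succ> u \<Longrightarrow> s \<succ> u"
  by (rule gt_compat[of t u]) (auto intro: ac_eq.refl ac_eq.sym gt_terms)

section \<open>Strict order and subterm property\<close>

lemma gt_trans: "s \<succ> t \<Longrightarrow> t \<succ> u \<Longrightarrow> s \<succ> u"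
proof (induction "size s + size t + size u" arbitrary: s t u rule: less_induct)
  case less
  note st = \<open>s \<succ> t\<close> and tu = \<open>t \<succ> u\<close>
  note T = gt_terms[OF st] gt_terms[OF tu]
  have prec_trans: "prec f g \<Longrightarrow> prec g h \<Longrightarrow> prec f h" for f g h
    using prec_order unfolding strict_order_over_def by (blast dest: transpD)
  \<comment> \<open>\<open>sub_t\<close> replaces the middle term by one of its pieces,
    \<open>below\<close> the last one; in both the sum of the sizes drops.\<close>
  have sub_t: "s \<succ> u" if "s \<succ> t'" "t' \<in># TF Fac t" "t' \<succ> u \<or> t' \<approx> u" for t'
    using less.hyps[of s t' u] TF_size[OF that(2)] that gt_eq[of s t' u] by auto
  have below: "s \<succ> u'" if "t \<succ> u'" "u' \<in># TF Fac u" for u'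
    using less.hyps[of s t u'] TF_size[OF that(2)] that st by auto
  from st show ?case
  proof (cases rule: gt_cases)
    case (sub f ss s')
    then have "s' \<succ> u"
      using less.hyps[of s' t u] TF_size[of s' Fac s] tu eq_gt[of s' t u] by auto
    with sub T show ?thesis by (intro gt_subI[of s s'])  simp_all
  next
    case st: (prec f ss g ts)
    from tu show ?thesis
    proof (cases rule: gt_cases)
      case (sub g' ts' t')
      with st(4) sub_t[of t'] show ?thesis by simp
    next
      case (prec g' ts' h us)
      have "prec f h" using prec_trans[of f g h] st prec by simp
      with st prec T below show ?thesis by (simp add: acmpo.prec del: TF.simps terms_over_Fun)
    next
      case (mul g' ts' us)
      \<comment> \<open>Every piece of \<open>u\<close> is below or equivalent to a piece of
        \<open>t\<close>, and \<open>s\<close> exceeds all pieces of \<open>t\<close> by the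
        \<open>prec\<close> clause.\<close>
      have "s \<succ> u'" if u': "u' \<in># TF Fac u" for u'
      proof -
        from ac_mul_gt_memR[OF mul(3) u'] obtain t' where
          t': "t' \<in># TF Fac t" "t' \<succ> u' \<or> t' \<approx> u'" by blast
        with st(4) have "s \<succ> t'" by simp
        then show ?thesis
          using less.hyps[of s t' u'] TF_size[OF t'(1)] TF_size[OF u'] t'(2) gt_eq[of s t' u'] by auto
      qed
      with mul st T show ?thesis by (simp add: acmpo.prec del: TF.simps terms_over_Fun)
    qed
  next
    case st: (mul f ss ts)
    from tu show ?thesis
    proof (cases rule: gt_cases)
      case (sub g' ts' t')
      \<comment> \<open>The piece \<open>t'\<close> of \<open>t\<close> is below or equivalent to a
        piece of \<open>s\<close>, which then witnesses the \<open>sub\<close> clause for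
        \<open>u\<close>.\<close>
      from ac_mul_gt_memR[OF st(3) sub(2)] obtain s' where
        s': "s' \<in># TF Fac s" "s' \<succ> t' \<or> s' \<approx> t'" by blast
      have "s' \<succ> u \<or> s' \<approx> u"
        using s'(2) sub(3) less.hyps[of s' t' u] TF_size[OF s'(1)] TF_size[OF sub(2)]
          gt_eq[of s' t' u] eq_gt[of s' t' u] ac_eq.trans[of F ar Fac s' t' u] by auto
      with s'(1) T(1) show ?thesis by (intro gt_subI[of s s'])
    next
      case (prec g' ts' h us)
      with st T below show ?thesis by (simp add: acmpo.prec del: TF.simps terms_over_Fun)
    next
      case (mul g' ts' us)
      have "ac_mul_gt (\<approx>) (\<succ>) (TF Fac s) (TF Fac u)"
      proof (rule ac_mul_gt_trans[OF st(3) mul(3)])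
        fix a b c assume "a \<in># TF Fac s" "b \<in># TF Fac t" "c \<in># TF Fac u" "a \<succ> b" "b \<succ> c"
        then show "a \<succ> c"
          using less.hyps[of a b c] TF_size[of a Fac s] TF_size[of b Fac t] TF_size[of c Fac u] by auto
      qed (fact gt_eq eq_gt ac_eq.trans)+
      with mul st T show ?thesis by (simp add: acmpo.mul del: TF.simps terms_over_Fun)
    qed
  qed
qed

lemma gt_irrefl: "\<not> s \<succ> s"
proof (induction "size s" arbitrary: s rule: less_induct)
  case less
  have irr: "\<not> u \<succ> u" if "u \<in># TF Fac s" for u
    using less TF_size[OF that] by blast
  show ?case
  proof
    assume s: "s \<succ> s"
    then have "s \<in> T" by (rule gt_terms)
    from s show False
    proof (cases rule: gt_cases)
      \<comment> \<open>The piece \<open>u\<close> also satisfies \<open>s \<succ> u\<close>, hence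
        would exceed itself, against the induction hypothesis.\<close>
      case (sub f ss u)
      then show False
        using irr gt_TF[OF \<open>s \<in> T\<close>, of u] gt_trans[of u s u] eq_gt[of u s u] by blast
    next
      case (prec f ss g ts)
      then show False using prec_order unfolding strict_order_over_def
        by (auto dest: irreflpD)
    next
      case (mul f ss ts)
      moreover have "\<not> ac_mul_gt (\<approx>) (\<succ>) (TF Fac s) (TF Fac s)"
      proof (rule ac_mul_gt_irrefl)
        show "u \<approx> u" if "u \<in># TF Fac s" for u
          using that \<open>s \<in> T\<close> by (blast intro: ac_eq.refl TF_terms)
      qed (fact irr gt_trans gt_eq ac_eq.sym ac_eq.trans)+
      ultimately show False by simp
    qed
  qed
qed

text \<open>An argument that is itself a piece falls under the \<open>sub\<close> clause. Otherwise
  its root is the AC symbol \<open>f\<close> and its flattening is a proper part of that of the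
  whole term, so the \<open>mul\<close> clause applies with the remaining pieces as strict
  part.\<close>

lemma gt_arg:
  assumes s: "Fun f ss \<in> T" and a: "a \<in> set ss"
  shows "Fun f ss \<succ> a"
proof (cases Fac f a rule: tf_at_cases)
  case atom
  with a have "a \<in># TF Fac (Fun f ss)" by (force simp: set_sum_list_mset)
  with s show ?thesis by (rule gt_TF)
next
  case (flat ts)
  from a obtain ls rs where ss: "ss = ls @ a # rs" by (auto simp: in_set_conv_decomp)
  \<comment> \<open>An AC symbol has arity 2, so an argument besides \<open>a\<close> exists and
    contributes at least one piece.\<close>
  with flat(1) s have "ls @ rs \<noteq> []" using AC_symbol(2)[of f] by auto
  then obtain b where "b \<in> set (ls @ rs)" using last_in_set by blast
  then have ne: "TF Fac (Fun f (ls @ rs)) \<noteq> {#}"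
    using tf_at_nonempty[of Fac f b] unfolding set_mset_eq_empty_iff[symmetric]
    by (auto simp: set_sum_list_mset)
  have "a \<in> T" using s a by auto
  have "ac_mul_gt (\<approx>) (\<succ>) (TF Fac (Fun f ss)) (TF Fac a)"
  proof (rule ac_mul_gtI)
    show "TF Fac (Fun f ss) = TF Fac a + TF Fac (Fun f (ls @ rs))"
      unfolding ss TF_Fun_split flat(3) by (rule add.commute)
    show "TF Fac a = TF Fac a + {#}" by simp
    show "rel_mset (\<approx>) (TF Fac a) (TF Fac a)"
      using \<open>a \<in> T\<close> by (blast intro: rel_mset_eq_refl TF_terms)
  qed (use ne in auto)
  then show ?thesis
    using s \<open>a \<in> T\<close> unfolding flat(2) by (intro acmpo.mul)
qed

lemma gt_subterm:
  assumes "t \<in> T" "u \<in> subterms t" "u \<noteq> t"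
  shows "t \<succ> u"
  using assms
proof (induction t rule: trm.induct)
  case (Fun f ts)
  then obtain a where a: "a \<in> set ts" "u \<in> subterms a" by auto
  with Fun have "Fun f ts \<succ> a" by (intro gt_arg)
  moreover have "a \<succ> u" if "u \<noteq> a" using Fun a that by auto
  ultimately show ?case using gt_trans[of "Fun f ts" a u] by blast
qed simp

section \<open>Closure under contexts and substitutions\<close>

lemma gt_subterms: "s \<succ> t \<Longrightarrow> u \<in> subterms t \<Longrightarrow> s \<succ> u"
  using gt_subterm[of t u] gt_trans[of s t u] gt_terms(2)[of s t] by blast

text \<open>Serves contexts, since below an \<open>f\<close> the terms contribute exactly these
  pieces. If \<open>s\<close> stays whole, it dominates all pieces of \<open>t\<close>; if it
  dissolves, the clause behind \<open>s \<succ> t\<close> decides.\<close>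

lemma gt_tf_at:
  assumes minimal: "\<forall>f \<in> Fac. \<not> (\<exists>g \<in> F. prec f g)" and st: "s \<succ> t"
  shows "ac_mul_gt (\<approx>) (\<succ>) (tf_at Fac f s) (tf_at Fac f t)"
proof -
  \<comment> \<open>Nothing is matched here: a single piece above \<open>t\<close> is above all
    pieces of \<open>t\<close>, as these are subterms of \<open>t\<close>.\<close>
  have dominated: ?thesis if "u \<in># tf_at Fac f s" "u \<succ> t" for u
  proof (rule ac_mul_gtI)
    show "rel_mset (\<approx>) {#} {#}" by simp
    show "\<exists>s' \<in># tf_at Fac f s. s' \<succ> t'" if "t' \<in># tf_at Fac f t" for t'
      using \<open>u \<in># _\<close> \<open>u \<succ> t\<close> that by (blast intro: gt_subterms tf_at_subterms)
  qed auto
  show ?thesis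
  proof (cases Fac f s rule: tf_at_cases)
    case atom
    with st dominated show ?thesis by auto
  next
    case (flat ss)
    from st show ?thesis
    proof (cases rule: gt_cases)
      case (sub f' ss' u)
      show ?thesis
      proof (cases "u \<succ> t")
        case True
        with sub flat dominated show ?thesis by metis
      next
        case False
        with sub have "u \<approx> t" by blast
        \<comment> \<open>Being a piece, \<open>u\<close> is not split again, so \<open>t\<close>
          contributes a single piece as well, and \<open>u\<close> is matched with it.\<close>
        have "tf_at Fac f u = {#u#}"
          using TF_top[of _ _ Fac f ss] sub(2) unfolding flat(2)
          by (cases u) (auto simp: tf_at_Fun simp del: TF.simps)
        with eq_tf_at[OF \<open>u \<approx> t\<close>, of f] have u: "rel_mset (\<approx>) {#u#} (tf_at Fac f t)" by simp
        from flat(1,2) gt_terms(1)[OF st] obtain x y where "ss = [x, y]" by (blast elim: AC_args)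
        with flat(2) have xy: "TF Fac s = tf_at Fac f x + tf_at Fac f y" by simp
        \<comment> \<open>Both arguments of \<open>f\<close> contribute a piece, so one remains
          besides \<open>u\<close> and makes the comparison strict, with nothing left to
          dominate.\<close>
        have "TF Fac s - {#u#} \<noteq> {#}"
        proof
          assume "TF Fac s - {#u#} = {#}"
          then have "TF Fac s = {#u#}" using sub(2) by (metis insert_DiffM)
          with xy tf_at_nonempty show False by (metis union_is_single)
        qed
        with u sub(2) show ?thesis unfolding flat(3)
          by (intro ac_mul_gtI[of _ "{#u#}" "TF Fac s - {#u#}" _ "tf_at Fac f t" "{#}"]) auto
      qed
    next
      case (prec f' ss' g ts)
      moreover have "g \<in> F" using gt_terms(2)[OF st] prec by simp
      ultimately show ?thesis using minimal flat by auto
    next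
      case (mul f' ss' ts)
      moreover have "tf_at Fac f t = TF Fac t"
        using mul flat gt_terms(2)[OF st] AC_symbol by (simp add: tf_at_Fun del: TF.simps)
      ultimately show ?thesis using flat by simp
    qed
  qed
qed

text \<open>Each context layer gives both terms the same root, so the \<open>mul\<close> clause
  applies: pieces of the side arguments are matched with themselves and join the matched part from
  \<open>gt_tf_at\<close>.\<close>

lemma gt_ctxt:
  assumes minimal: "\<forall>f \<in> Fac. \<not> (\<exists>g \<in> F. prec f g)"
  shows "ctxt_over F ar C \<Longrightarrow> s \<succ> t \<Longrightarrow> fill C s \<succ> fill C t"
proof (induction C)
  case (More f ls C rs)
  let ?s = "fill C s" and ?t = "fill C t" and ?M = "TF Fac (Fun f (ls @ rs))"
  have st: "?s \<succ> ?t" using More by simp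
  obtain S1 S2 T1 T2 where
    *: "tf_at Fac f ?s = S1 + S2" "tf_at Fac f ?t = T1 + T2" "rel_mset (\<approx>) S1 T1" "S2 \<noteq> {#}"
      "\<And>t. t \<in># T2 \<Longrightarrow> \<exists>s \<in># S2. s \<succ> t"
    using gt_tf_at[OF minimal st, of f] by (rule ac_mul_gtE) blast
  have "rel_mset (\<approx>) ?M ?M"
    using More.prems by (intro rel_mset_eq_refl) (auto simp: set_sum_list_mset intro: tf_at_terms)
  with * have "ac_mul_gt (\<approx>) (\<succ>) (TF Fac (Fun f (ls @ ?s # rs))) (TF Fac (Fun f (ls @ ?t # rs)))"
    unfolding TF_Fun_split
    by (intro ac_mul_gtI[of _ "?M + S1" S2 _ "?M + T1" T2]) (auto simp: ac_simps intro: rel_mset_union)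
  moreover have "Fun f (ls @ ?s # rs) \<in> T" "Fun f (ls @ ?t # rs) \<in> T"
    using More.prems gt_terms[OF st] by auto
  ultimately show ?case by (simp add: acmpo.mul del: TF.simps terms_over_Fun)
qed simp

lemma eq_subst:
  assumes "s \<approx> t" and \<sigma>: "range \<sigma> \<subseteq> T"
  shows "subst \<sigma> s \<approx> subst \<sigma> t"
  using assms(1)
proof (induction rule: ac_eq.induct)
  case (trans s t u)
  then show ?case by (blast intro: ac_eq.trans)
next
  case (cong f ss ts)
  then show ?case by (auto intro!: ac_eq.cong simp: list_all2_map1 list_all2_map2 elim: list_all2_mono)
qed (auto intro: ac_eq.assoc ac_eq.comm ac_eq.refl ac_eq.sym terms_over_subst[OF _ \<sigma>])

lemma gt_subst:
  assumes "s \<succ> t" and \<sigma>: "range \<sigma> \<subseteq> T"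
  shows "subst \<sigma> s \<succ> subst \<sigma> t"
  using assms(1)
proof (induction rule: acmpo.induct)
  case (sub f ss t u)
  \<comment> \<open>The instance of \<open>u\<close> may be split by flattening and need not be a
    piece, so the subterm property and transitivity replace the \<open>sub\<close> clause.\<close>
  have "proper_subterm (subst \<sigma> u) (subst \<sigma> (Fun f ss))"
    using sub.hyps(3) by (intro proper_subterm_subst TF_proper_subterm)
  moreover have "subst \<sigma> (Fun f ss) \<in> T" using sub.hyps(1) \<sigma> by (rule terms_over_subst)
  ultimately have "subst \<sigma> (Fun f ss) \<succ> subst \<sigma> u"
    unfolding proper_subterm_def by (blast intro: gt_subterm)
  moreover have "subst \<sigma> u \<succ> subst \<sigma> t \<or> subst \<sigma> u \<approx> subst \<sigma> t"
    using sub.IH eq_subst[OF _ \<sigma>] by blast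
  ultimately show ?case by (blast intro: gt_trans gt_eq)
next
  case (prec f ss g ts)
  have "subst \<sigma> (Fun f ss) \<succ> u" if "u \<in># TF Fac (subst \<sigma> (Fun g ts))" for u
  proof -
    from that obtain t' where t': "t' \<in># TF Fac (Fun g ts)" "u \<in># tf_at Fac g (subst \<sigma> t')"
      unfolding TF_subst by (auto simp del: TF.simps)
    with prec.IH have "subst \<sigma> (Fun f ss) \<succ> subst \<sigma> t'" by blast
    with t'(2) show ?thesis by (blast intro: gt_subterms tf_at_subterms)
  qed
  with prec.hyps terms_over_subst[OF prec.hyps(1) \<sigma>] terms_over_subst[OF prec.hyps(2) \<sigma>]
  show ?case by (simp add: acmpo.prec del: TF.simps terms_over_Fun)
next
  case (mul f ss ts)
  \<comment> \<open>The uninstantiated comparison is kept in \<open>gt\<close>, since it shows that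
    the larger term is not a variable.\<close>
  from mul.IH obtain S1 S2 T1 T2 where
    *: "TF Fac (Fun f ss) = S1 + S2" "TF Fac (Fun f ts) = T1 + T2" "rel_mset (\<approx>) S1 T1" "S2 \<noteq> {#}"
    and gt: "\<And>t. t \<in># T2 \<Longrightarrow> \<exists>s \<in># S2. s \<succ> t \<and> subst \<sigma> s \<succ> subst \<sigma> t"
    by (rule ac_mul_gtE) blast
  let ?h = "\<lambda>M. \<Sum>u\<in>#M. tf_at Fac f (subst \<sigma> u)"
  have "ac_mul_gt (\<approx>) (\<succ>) (TF Fac (subst \<sigma> (Fun f ss))) (TF Fac (subst \<sigma> (Fun f ts)))"
  proof (rule ac_mul_gtI)
    show "TF Fac (subst \<sigma> (Fun f ss)) = ?h S1 + ?h S2" "TF Fac (subst \<sigma> (Fun f ts)) = ?h T1 + ?h T2"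
      unfolding TF_subst * by simp_all
    show "rel_mset (\<approx>) (?h S1) (?h T1)"
      using *(3) by (rule rel_mset_sum_mset) (intro eq_tf_at eq_subst \<sigma>)
    from *(4) obtain s M where "S2 = add_mset s M" by (metis multiset_cases)
    then show "?h S2 \<noteq> {#}" by simp
    fix t assume "t \<in># ?h T2"
    then obtain t' where t': "t' \<in># T2" "t \<in># tf_at Fac f (subst \<sigma> t')" by auto
    with gt obtain s where s: "s \<in># S2" "s \<succ> t'" "subst \<sigma> s \<succ> subst \<sigma> t'" by blast
    \<comment> \<open>Being above something, \<open>s\<close> is not a variable; as a non-variable
      piece it survives instantiation unsplit.\<close>
    from s(2) obtain g us where g: "s = Fun g us" by (cases rule: gt_cases)
    have "Fun g us \<in># TF Fac (Fun f ss)" unfolding *(1) using s(1) g by simp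
    then have "\<not> (g = f \<and> f \<in> Fac \<and> length us = 2)" by (rule TF_top)
    then have "tf_at Fac f (subst \<sigma> s) = {#subst \<sigma> s#}" by (auto simp: g tf_at_Fun simp del: TF.simps)
    with s(1) have "subst \<sigma> s \<in># ?h S2" by (auto intro!: bexI[of _ s])
    moreover have "subst \<sigma> s \<succ> t" using s(3) t'(2) by (blast intro: gt_subterms tf_at_subterms)
    ultimately show "\<exists>s \<in># ?h S2. s \<succ> t" by blast
  qed
  with terms_over_subst[OF mul.hyps(1) \<sigma>] terms_over_subst[OF mul.hyps(2) \<sigma>]
  show ?case by (simp add: acmpo.mul del: TF.simps terms_over_Fun)
qed

end

section \<open>Incrementality and conclusion\<close>

lemma acmpo_mono:
  assumes "acmpo F ar Fac p s t" "p \<le> q"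
  shows "acmpo F ar Fac q s t"
  using assms(1)
proof (induction rule: acmpo.induct)
  case (sub f ss t u)
  then show ?case by (blast intro: acmpo.sub)
next
  case (prec f ss g ts)
  then show ?case using assms(2) by (blast intro: acmpo.prec)
next
  case (mul f ss ts)
  from mul.IH have "ac_mul_gt (ac_eq F ar Fac) (acmpo F ar Fac q) (TF Fac (Fun f ss)) (TF Fac (Fun f ts))"
    by (rule ac_mul_gt_mono[rule_format, rotated]) blast
  with mul.hyps show ?case by (blast intro: acmpo.mul)
qed

theorem theorem5p3:
  fixes F :: "'f set" and ar :: "'f \<Rightarrow> nat" and Fac :: "'f set"
    and prec :: "'f \<Rightarrow> 'f \<Rightarrow> bool"
  assumes "countable (UNIV :: 'v set)" and "infinite (UNIV :: 'v set)"
    and "ac_signature F ar Fac"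
    and "precedence F prec"
    and "\<forall>f \<in> Fac. \<not> (\<exists>g \<in> F. prec f g)"
  shows "incremental F (acmpo F ar Fac :: _ \<Rightarrow> ('f, 'v) trm \<Rightarrow> ('f, 'v) trm \<Rightarrow> bool) \<and>
    ac_compatible F ar Fac (acmpo F ar Fac prec :: ('f, 'v) trm \<Rightarrow> ('f, 'v) trm \<Rightarrow> bool) \<and>
    rewrite_order F ar (acmpo F ar Fac prec :: ('f, 'v) trm \<Rightarrow> ('f, 'v) trm \<Rightarrow> bool) \<and>
    subterm_property F ar (acmpo F ar Fac prec :: ('f, 'v) trm \<Rightarrow> ('f, 'v) trm \<Rightarrow> bool)"
proof (intro conjI)
  interpret ac_precedence F ar Fac prec
    using assms(3,4) by unfold_locales
  let ?gt = "acmpo F ar Fac prec :: ('f, 'v) trm \<Rightarrow> ('f, 'v) trm \<Rightarrow> bool"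
  show "incremental F (acmpo F ar Fac :: _ \<Rightarrow> ('f, 'v) trm \<Rightarrow> ('f, 'v) trm \<Rightarrow> bool)"
    unfolding incremental_def by (blast intro: acmpo_mono)
  show "ac_compatible F ar Fac ?gt"
    unfolding ac_compatible_def by (blast intro: gt_eq eq_gt)
  have "strict_order_over (terms_over F ar) ?gt"
    unfolding strict_order_over_def
    by (auto intro!: irreflpI transpI simp: gt_irrefl intro: gt_trans dest: gt_terms)
  then show "rewrite_order F ar ?gt"
    unfolding rewrite_order_def ctxt_closed_def subst_closed_def
    using gt_ctxt[OF assms(5)] gt_subst by blast
  show "subterm_property F ar ?gt"
    unfolding subterm_property_def proper_subterm_def by (blast intro: gt_subterm)
qed

end
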